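(* Let $n\ge 1$ and let $A:[0,1]^n\to[0,1]$ be $A(x_1,\dots,x_n)=\min(x_1,\dots,x_n)$. Let $S_M(x,y)=\max(x,y)$ on $[0,1]$. A fuzzy subset $\sigma:[0,1]\to[0,1]$ is an $A$-fuzzy $t$-subconorm of $S_M$ if and only if $\sigma(0)=1$.
   Context: For an aggregation operator $A:[0,1]^n\to[0,1]$ (non-decreasing in each argument, $A(0,\dots,0)=0$, $A(1,\dots,1)=1$) and a monoid $(M,\circ)$ with identity $e$, a map $\sigma:M\to[0,1]$ is an $A$-fuzzy submonoid of $M$ if $A(\sigma(x_1),\dots,\sigma(x_n))\le\sigma(x_1\circ\cdots\circ x_n)$ for all $x_1,\dots,x_n\in M$ and $\sigma(e)=1$. For a $t$-conorm $S$ (a commutative, associative, coordinatewise non-decreasing operation on $[0,1]$ with identity $0$), an $A$-fuzzy $t$-subconorm of $S$ is an $A$-fuzzy submonoid of the monoid $([0,1],S)$, whose identity is $0$. *)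

theory Defs
  imports Complex_Main "HOL-Algebra.Group"
begin

text \<open>Points of \<open>X^n\<close> are lists of length \<open>n\<close> with entries in \<open>X\<close>; functions on the unit
  interval are functions on the reals of which only the values on \<open>{0..1}\<close> matter.\<close>

definition tuples :: "nat \<Rightarrow> 'a set \<Rightarrow> 'a list set" where
  "tuples n X = {xs. length xs = n \<and> set xs \<subseteq> X}"

definition aggregation_operator :: "nat \<Rightarrow> (real list \<Rightarrow> real) \<Rightarrow> bool" where
  "aggregation_operator n A \<longleftrightarrow>
     A \<in> tuples n {0..1} \<rightarrow> {0..1} \<and>
     (\<forall>xs \<in> tuples n {0..1}. \<forall>i < n. \<forall>y \<in> {0..1}. xs ! i \<le> y \<longrightarrow> A xs \<le> A (xs[i := y])) \<and>
     A (replicate n 0) = 0 \<and> A (replicate n 1) = 1"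

definition fuzzy_subset :: "'a set \<Rightarrow> ('a \<Rightarrow> real) \<Rightarrow> bool" where
  "fuzzy_subset X \<sigma> \<longleftrightarrow> \<sigma> \<in> X \<rightarrow> {0..1}"

text \<open>The standing requirements that \<open>A\<close> is an aggregation operator and \<open>M\<close> a monoid (below: that
  \<open>S\<close> is a t-conorm) are conjuncts of the predicates.\<close>

definition fuzzy_submonoid ::
  "nat \<Rightarrow> (real list \<Rightarrow> real) \<Rightarrow> ('a, 'b) monoid_scheme \<Rightarrow> ('a \<Rightarrow> real) \<Rightarrow> bool" where
  "fuzzy_submonoid n A M \<sigma> \<longleftrightarrow>
     aggregation_operator n A \<and> monoid M \<and> fuzzy_subset (carrier M) \<sigma> \<and>
     (\<forall>xs \<in> tuples n (carrier M). A (map \<sigma> xs) \<le> \<sigma> (foldr (\<otimes>\<^bsub>M\<^esub>) xs \<one>\<^bsub>M\<^esub>)) \<and>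
     \<sigma> \<one>\<^bsub>M\<^esub> = 1"

definition t_conorm :: "(real \<Rightarrow> real \<Rightarrow> real) \<Rightarrow> bool" where
  "t_conorm S \<longleftrightarrow>
     (\<forall>x \<in> {0..1}. \<forall>y \<in> {0..1}. S x y \<in> {0..1}) \<and>
     (\<forall>x \<in> {0..1}. \<forall>y \<in> {0..1}. S x y = S y x) \<and>
     (\<forall>x \<in> {0..1}. \<forall>y \<in> {0..1}. \<forall>z \<in> {0..1}. S (S x y) z = S x (S y z)) \<and>
     (\<forall>x \<in> {0..1}. \<forall>x' \<in> {0..1}. \<forall>y \<in> {0..1}. x \<le> x' \<longrightarrow> S x y \<le> S x' y) \<and>
     (\<forall>x \<in> {0..1}. \<forall>y \<in> {0..1}. \<forall>y' \<in> {0..1}. y \<le> y' \<longrightarrow> S x y \<le> S x y') \<and>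
     (\<forall>x \<in> {0..1}. S x 0 = x \<and> S 0 x = x)"

definition t_conorm_monoid :: "(real \<Rightarrow> real \<Rightarrow> real) \<Rightarrow> real monoid" where
  "t_conorm_monoid S = \<lparr>carrier = {0..1}, mult = S, one = 0\<rparr>"

definition fuzzy_t_subconorm ::
  "nat \<Rightarrow> (real list \<Rightarrow> real) \<Rightarrow> (real \<Rightarrow> real \<Rightarrow> real) \<Rightarrow> (real \<Rightarrow> real) \<Rightarrow> bool" where
  "fuzzy_t_subconorm n A S \<sigma> \<longleftrightarrow> t_conorm S \<and> fuzzy_submonoid n A (t_conorm_monoid S) \<sigma>"

end

theory Submission
  imports Defs
begin

text \<open>The unit interval is a chain, so the maximum of x_1, ..., x_n with n >= 1 is some x_j.
  Its degree is thus one of those whose minimum is taken, and the submonoid inequality holds for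
  every fuzzy subset (\<open>foldr_max_in_set\<close>). Only the condition at the identity 0
  remains.\<close>

text \<open>The maximum of finitely many points is one of these points, so its membership degree is among
  those over which the minimum is taken.\<close>

lemma foldr_max_in_set:
  fixes xs :: "'a::linorder list"
  assumes "xs \<noteq> []" and "\<And>x. x \<in> set xs \<Longrightarrow> b \<le> x"
  shows "foldr max xs b \<in> set xs"
  using assms
proof (induction xs)
  case (Cons x xs)
  then show ?case
    by (cases "xs = []") (auto simp: max_def)
qed simp

text \<open>Raising one entry keeps the old minimum a lower bound of all entries. This gives the
  monotonicity clause of \<open>aggregation_operator\<close>.\<close>

lemma Min_set_list_update_mono:
  fixes xs :: "'a::linorder list"
  assumes "i < length xs" and "xs ! i \<le> y"
  shows "Min (set xs) \<le> Min (set (xs[i := y]))"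
proof -
  have "Min (set xs) \<le> xs[i := y] ! j" if "j < length xs" for j
  proof (cases "j = i")
    case True
    have "Min (set xs) \<le> xs ! i"
      using assms(1) by simp
    also have "\<dots> \<le> xs[i := y] ! j"
      using True assms by simp
    finally show ?thesis .
  next
    case False
    with that show ?thesis
      by simp
  qed
  with assms(1) show ?thesis
    by (subst Min_ge_iff) (auto simp: in_set_conv_nth)
qed

lemma aggregation_operator_Min:
  assumes "n \<ge> 1"
  shows "aggregation_operator n (\<lambda>xs. Min (set xs))"
proof -
  have "Min (set xs) \<in> {0..1}" if "xs \<in> tuples n {0..1}" for xs :: "real list"
  proof -
    \<comment> \<open>Since \<open>n \<ge> 1\<close>, the list is nonempty and \<open>Min\<close> is
      attained.\<close>
    from that assms have "Min (set xs) \<in> set xs" and "set xs \<subseteq> {0..1}"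
      by (auto simp: tuples_def intro!: Min_in)
    then show ?thesis
      by blast
  qed
  with assms show ?thesis
    by (auto simp: aggregation_operator_def tuples_def Min_set_list_update_mono set_replicate_conv_if)
qed

lemma t_conorm_max: "t_conorm max"
  by (auto simp: t_conorm_def max_def)

lemma monoid_t_conorm_monoid:
  assumes "t_conorm S"
  shows "monoid (t_conorm_monoid S)"
  using assms by unfold_locales (auto simp: t_conorm_def t_conorm_monoid_def)

theorem proposition3p3:
  fixes n :: nat and \<sigma> :: "real \<Rightarrow> real"
  assumes "n \<ge> 1" and "fuzzy_subset {0..1} \<sigma>"
  shows "fuzzy_t_subconorm n (\<lambda>xs. Min (set xs)) max \<sigma> \<longleftrightarrow> \<sigma> 0 = 1"
proof -
  have "Min (set (map \<sigma> xs)) \<le> \<sigma> (foldr max xs 0)" if "xs \<in> tuples n {0..1}" for xs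
  proof -
    \<comment> \<open>The start value 0 of the fold lies below all entries, so the result is an
      entry of the nonempty list.\<close>
    from that assms(1) have "foldr max xs 0 \<in> set xs"
      by (intro foldr_max_in_set) (auto simp: tuples_def)
    then show ?thesis
      by simp
  qed
  with assms show ?thesis
    using aggregation_operator_Min[OF assms(1)] t_conorm_max monoid_t_conorm_monoid[OF t_conorm_max]
    by (auto simp: fuzzy_t_subconorm_def fuzzy_submonoid_def t_conorm_monoid_def)
qed

end
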